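(* Let $F$ be an algebraically closed field of characteristic different from $2$. Every simple unital commutative $3$-dimensional algebra over $F$ of nil-rank $2$ is isotopic to $J_2$, the Jordan algebra of a symmetric bilinear nondegenerate form on a $2$-dimensional vector space over $F$.
   Context: An algebra over $F$ is a vector space with a bilinear multiplication (not necessarily associative). An algebra is simple if its multiplication is nonzero and it has no ideals other than $0$ and itself. A nonzero element $x$ of an algebra is a nil-element of index $2$ if $x^2=0$; the nil-rank of an algebra is the maximal number of linearly independent nil-elements of index $2$ contained in it. Two algebras $(A,\cdot)$ and $(B,\circ)$ over $F$ are isotopic if there are linear isomorphisms $\varphi,\psi,\xi:A\to B$ with $\varphi(a)\circ\psi(b)=\xi(a\cdot b)$ for all $a,b\in A$. The algebra $J_2=F1\oplus V_2$, where $V_2$ is a $2$-dimensional space with a nondegenerate symmetric bilinear form $f$, has product $(\alpha 1+u)(\beta 1+v)=(\alpha\beta+f(u,v))1+(\alpha v+\beta u)$ for $\alpha,\beta\in F$, $u,v\in V_2$. Choosing a basis $x,y$ of $V_2$ with $f(x,x)=f(y,y)=0$, $f(x,y)=1$, the algebra $J_2$ is the unital commutative algebra with basis $1,x,y$ and $x^2=y^2=0$, $xy=1$. *)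

theory Defs
  imports
    "HOL-Analysis.Product_Vector"
    "HOL-Computational_Algebra.Polynomial"
    "HOL-Library.Extended_Nat"
begin

section \<open>Algebras that need not be associative\<close>

locale nonassoc_algebra = vector_space scale
  for scale :: "'f::field \<Rightarrow> 'a::ab_group_add \<Rightarrow> 'a" +
  fixes mult :: "'a \<Rightarrow> 'a \<Rightarrow> 'a"
  assumes linear_mult_left: "Vector_Spaces.linear scale scale (\<lambda>a. mult a b)"
    and linear_mult_right: "Vector_Spaces.linear scale scale (\<lambda>b. mult a b)"
begin

definition commutative :: bool where
  "commutative \<longleftrightarrow> (\<forall>a b. mult a b = mult b a)"

definition unital :: bool where
  "unital \<longleftrightarrow> (\<exists>e. \<forall>a. mult e a = a \<and> mult a e = a)"

definition ideal :: "'a set \<Rightarrow> bool" where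
  "ideal I \<longleftrightarrow> subspace I \<and> (\<forall>a. \<forall>i\<in>I. mult a i \<in> I \<and> mult i a \<in> I)"

definition simple :: bool where
  "simple \<longleftrightarrow> (\<exists>a b. mult a b \<noteq> 0) \<and> (\<forall>I. ideal I \<longrightarrow> I = {0} \<or> I = UNIV)"

definition nil2_elements :: "'a set" where
  "nil2_elements = {x. x \<noteq> 0 \<and> mult x x = 0}"

text \<open>The supremum is taken in \<^typ>\<open>enat\<close> so that it is meaningful even when the
  cardinalities are unbounded; a finite value is attained, i.e. it is a maximum.\<close>

definition nil_rank :: enat where
  "nil_rank = (SUP S \<in> {S. finite S \<and> S \<subseteq> nil2_elements \<and> independent S}. enat (card S))"

end

definition isotopic ::
  "('f::field \<Rightarrow> 'a::ab_group_add \<Rightarrow> 'a) \<Rightarrow> ('a \<Rightarrow> 'a \<Rightarrow> 'a) \<Rightarrow>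
   ('f \<Rightarrow> 'b::ab_group_add \<Rightarrow> 'b) \<Rightarrow> ('b \<Rightarrow> 'b \<Rightarrow> 'b) \<Rightarrow> bool" where
  "isotopic scaleA multA scaleB multB \<longleftrightarrow>
     (\<exists>\<phi> \<psi> \<xi>.
        Vector_Spaces.linear scaleA scaleB \<phi> \<and> bij \<phi> \<and>
        Vector_Spaces.linear scaleA scaleB \<psi> \<and> bij \<psi> \<and>
        Vector_Spaces.linear scaleA scaleB \<xi> \<and> bij \<xi> \<and>
        (\<forall>a b. multB (\<phi> a) (\<psi> b) = \<xi> (multA a b)))"


section \<open>The Jordan algebra of a symmetric bilinear form\<close>

locale symmetric_bilinear_form = vector_space scale
  for scale :: "'f::field \<Rightarrow> 'v::ab_group_add \<Rightarrow> 'v" +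
  fixes form :: "'v \<Rightarrow> 'v \<Rightarrow> 'f"
  assumes form_sym: "form u v = form v u"
    and linear_form: "Vector_Spaces.linear scale (*) (form u)"
begin

definition nondegenerate :: bool where
  "nondegenerate \<longleftrightarrow> (\<forall>u. (\<forall>v. form u v = 0) \<longrightarrow> u = 0)"

text \<open>The pair \<open>(\<alpha>, u)\<close> stands for \<open>\<alpha>1 + u\<close> in \<open>F1 \<oplus> V\<close>.\<close>

definition jordan_scale :: "'f \<Rightarrow> 'f \<times> 'v \<Rightarrow> 'f \<times> 'v" where
  "jordan_scale = module_prod.scale (*) scale"

definition jordan_mult :: "'f \<times> 'v \<Rightarrow> 'f \<times> 'v \<Rightarrow> 'f \<times> 'v" where
  "jordan_mult = (\<lambda>(\<alpha>, u) (\<beta>, v). (\<alpha> * \<beta> + form u v, scale \<alpha> v + scale \<beta> u))"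

lemma vector_space_field: "vector_space ((*) :: 'f \<Rightarrow> 'f \<Rightarrow> 'f)"
  by unfold_locales (simp_all add: algebra_simps)

lemma module_prod_field: "module_prod ((*) :: 'f \<Rightarrow> 'f \<Rightarrow> 'f) scale"
  by unfold_locales (simp_all add: algebra_simps)

lemma jordan_scale_simp: "jordan_scale c (\<alpha>, u) = (c * \<alpha>, scale c u)"
  by (simp add: jordan_scale_def module_prod.scale_prod[OF module_prod_field])

lemma jordan_mult_simp:
  "jordan_mult (\<alpha>, u) (\<beta>, v) = (\<alpha> * \<beta> + form u v, scale \<alpha> v + scale \<beta> u)"
  by (simp add: jordan_mult_def)

lemma form_add: "form u (v + w) = form u v + form u w"
  and form_scale: "form u (scale c v) = c * form u v"
proof -
  interpret l: Vector_Spaces.linear scale "(*)" "form u" by (rule linear_form)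
  show "form u (v + w) = form u v + form u w" by (rule l.add)
  show "form u (scale c v) = c * form u v" by (rule l.scale)
qed

lemma vector_space_jordan: "vector_space jordan_scale"
  by unfold_locales
    (auto simp: jordan_scale_simp algebra_simps scale_right_distrib scale_left_distrib)

lemma jordan_mult_commute: "jordan_mult x y = jordan_mult y x"
  by (cases x; cases y) (simp add: jordan_mult_simp form_sym[of "snd x"] algebra_simps form_sym)

lemma linear_jordan_mult: "Vector_Spaces.linear jordan_scale jordan_scale (jordan_mult x)"
proof -
  obtain \<alpha> u where "x = (\<alpha>, u)" by (cases x)
  then show ?thesis
    using vector_space_jordan
    by (auto simp: Vector_Spaces.linear_iff jordan_scale_simp jordan_mult_simp form_add form_scale
      algebra_simps scale_right_distrib scale_left_distrib)
qed

lemma jordan_algebra: "nonassoc_algebra jordan_scale jordan_mult"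
proof (intro nonassoc_algebra.intro nonassoc_algebra_axioms.intro vector_space_jordan)
  show "Vector_Spaces.linear jordan_scale jordan_scale (\<lambda>a. jordan_mult a b)" for b
    using linear_jordan_mult[of b] by (subst jordan_mult_commute)
  show "Vector_Spaces.linear jordan_scale jordan_scale (\<lambda>b. jordan_mult a b)" for a
    by (rule linear_jordan_mult)
qed

lemma jordan_unit: "jordan_mult (1, 0) x = x"
  using form_scale[of "snd x" 0 0] by (cases x) (simp add: jordan_mult_simp form_sym[of 0])

lemma jordan_hyperbolic_basis:
  assumes "form x x = 0" "form y y = 0" "form x y = 1"
  shows "jordan_mult (0, x) (0, x) = 0" "jordan_mult (0, y) (0, y) = 0"
    "jordan_mult (0, x) (0, y) = (1, 0)"
  using assms by (simp_all add: jordan_mult_simp zero_prod_def)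

end

text \<open>The hyperbolic plane: such forms exist on a two-dimensional space over every field.\<close>

lemma hyperbolic_plane:
  fixes s :: "'f::field \<Rightarrow> 'f \<times> 'f \<Rightarrow> 'f \<times> 'f" and h :: "'f \<times> 'f \<Rightarrow> 'f \<times> 'f \<Rightarrow> 'f"
  defines "s \<equiv> \<lambda>c (a, b). (c * a, c * b)"
    and "h \<equiv> \<lambda>(a, b) (c, d). a * d + b * c"
  shows "symmetric_bilinear_form s h" "symmetric_bilinear_form.nondegenerate h"
    "vector_space.dim s UNIV = 2"
proof -
  have vs: "vector_space s"
    by unfold_locales (auto simp: s_def algebra_simps)
  have vF: "vector_space ((*) :: 'f \<Rightarrow> 'f \<Rightarrow> 'f)"
    by unfold_locales (simp_all add: algebra_simps)
  interpret V: vector_space s by (rule vs)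
  show sbf: "symmetric_bilinear_form s h"
  proof (intro symmetric_bilinear_form.intro symmetric_bilinear_form_axioms.intro vs)
    show "h u v = h v u" for u v
      by (cases u; cases v) (simp add: h_def algebra_simps)
    show "Vector_Spaces.linear s (*) (h u)" for u
      using vs vF by (cases u) (auto simp: Vector_Spaces.linear_iff s_def h_def algebra_simps)
  qed
  have "u = 0" if "\<forall>v. h u v = 0" for u
    using that[rule_format, of "(1, 0)"] that[rule_format, of "(0, 1)"]
    by (cases u) (simp add: h_def zero_prod_def)
  then show "symmetric_bilinear_form.nondegenerate h"
    by (simp add: symmetric_bilinear_form.nondegenerate_def[OF sbf])
  let ?B = "{(1, 0), (0, 1)} :: ('f \<times> 'f) set"
  have span: "x \<in> V.span ?B" for x
  proof -
    have "s (fst x) (1, 0) + s (snd x) (0, 1) \<in> V.span ?B"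
      by (intro V.span_add V.span_scale V.span_base) auto
    then show ?thesis by (cases x) (simp add: s_def)
  qed
  have sp1: "V.span {(0, 1)} = range (\<lambda>k. s k (0, 1))"
    by (rule V.span_singleton)
  have "(1, 0) \<notin> V.span {(0, 1)}"
    unfolding sp1 by (auto simp: s_def)
  then have "V.independent ?B"
    by (simp add: V.independent_insert zero_prod_def)
  then show "V.dim UNIV = 2"
    using span by (intro V.dim_unique[of ?B]) auto
qed

end

theory Submission
  imports Defs
begin

text \<open>
  Let \<open>x, y\<close> be independent nil-elements of index \<open>2\<close> in the algebra \<open>A\<close> with unit \<open>1\<close>. Then
  \<open>1, x, y\<close> is a basis, so \<open>A\<close> is determined by \<open>xy = \<alpha>1 + \<beta>x + \<gamma>y\<close>. If \<open>\<alpha> = 0\<close>, the span of \<open>x\<close>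
  and \<open>y\<close> would be a proper ideal; so \<open>\<alpha> \<noteq> 0\<close>, and rescaling \<open>x\<close> gives \<open>\<alpha> = 1\<close>. If
  \<open>\<beta>\<gamma> = -2\<close>, the element \<open>-\<beta>1 - (\<beta>\<^sup>2/2)x + y\<close> would be a third independent nil-element, so nil-rank
  \<open>2\<close> forces \<open>\<beta>\<gamma> \<noteq> -2\<close> (\<open>simple_imp_unit_coefficient\<close>, \<open>nil_rank_2_imp_parameters\<close>).

  What remains is a two-parameter family of multiplications on coordinate triples, and the key
  point is that all its members with \<open>\<beta>\<gamma> \<noteq> -2\<close> are isotopic to the member \<open>\<beta> = \<gamma> = 0\<close>
  (\<open>isotopic_triple_mult_zero\<close>). The isotopy is suggested by the determinant of multiplication by
  \<open>a = a\<^sub>01 + a\<^sub>1x + a\<^sub>2y\<close>, which an isotopy has to preserve up to a linear substitution and a factor.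
  This determinant is
  \[ a_0 (a_0^2 + \gamma a_0 a_1 + \beta a_0 a_2 - 2 a_1 a_2)
     = a_0 (\delta a_0^2 - 2 (a_1 - \beta a_0/2)(a_2 - \gamma a_0/2)), \]
  with \<open>\<delta> = 1 + \<beta>\<gamma>/2 \<noteq> 0\<close>. So the substitution
  \<open>(a\<^sub>0, a\<^sub>1, a\<^sub>2) \<mapsto> (s a\<^sub>0, a\<^sub>1 - \<beta>a\<^sub>0/2, a\<^sub>2 - \<gamma>a\<^sub>0/2)\<close> with \<open>s\<^sup>2 = \<delta>\<close> turns it into a multiple of
  the determinant \<open>a\<^sub>0 (a\<^sub>0\<^sup>2 - 2 a\<^sub>1 a\<^sub>2)\<close> of \<open>J\<^sub>2\<close>, and this substitution, used on both factors, indeed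
  is an isotopy. Finally, a nondegenerate symmetric form on a plane over an algebraically closed
  field of characteristic other than \<open>2\<close> has a hyperbolic basis, which identifies its Jordan
  algebra with the member
  \<open>\<beta> = \<gamma> = 0\<close>.
\<close>


section \<open>Symmetry and transitivity of isotopy\<close>

lemma linear_inv_bij:
  assumes "Vector_Spaces.linear s1 s2 f" and "bij f"
  shows "Vector_Spaces.linear s2 s1 (inv f)"
proof -
  have f: "f (x + y) = f x + f y" "f (s1 c x) = s2 c (f x)" for x y c
    using assms(1) by (auto simp: Vector_Spaces.linear_iff)
  have "inv f (x + y) = inv f x + inv f y" "inv f (s2 c x) = s1 c (inv f x)" for x y c
    using assms(2) by (auto intro!: inv_f_eq simp: f bij_is_inj surj_f_inv_f[OF bij_is_surj])
  then show ?thesis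
    using assms(1) by (auto simp: Vector_Spaces.linear_iff)
qed

lemma isotopic_sym:
  assumes "isotopic sA mA sB mB"
  shows "isotopic sB mB sA mA"
proof -
  obtain p q r where
    lin: "Vector_Spaces.linear sA sB p" "Vector_Spaces.linear sA sB q" "Vector_Spaces.linear sA sB r"
    and bij: "bij p" "bij q" "bij r"
    and eq: "\<And>a b. mB (p a) (q b) = r (mA a b)"
    using assms unfolding isotopic_def by blast
  have "mA (inv p a) (inv q b) = inv r (mB a b)" for a b
    using eq[of "inv p a" "inv q b"] bij
    by (simp add: surj_f_inv_f[OF bij_is_surj] bij_is_inj)
  then show ?thesis
    unfolding isotopic_def using lin bij
    by (intro exI[of _ "inv p"] exI[of _ "inv q"] exI[of _ "inv r"])
      (simp add: linear_inv_bij bij_imp_bij_inv)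
qed

lemma isotopic_trans:
  assumes "isotopic sA mA sB mB" and "isotopic sB mB sC mC"
  shows "isotopic sA mA sC mC"
proof -
  obtain p q r where
    lin: "Vector_Spaces.linear sA sB p" "Vector_Spaces.linear sA sB q" "Vector_Spaces.linear sA sB r"
    and bij: "bij p" "bij q" "bij r"
    and eq: "\<And>a b. mB (p a) (q b) = r (mA a b)"
    using assms(1) unfolding isotopic_def by blast
  obtain p' q' r' where
    lin': "Vector_Spaces.linear sB sC p'" "Vector_Spaces.linear sB sC q'"
      "Vector_Spaces.linear sB sC r'"
    and bij': "bij p'" "bij q'" "bij r'"
    and eq': "\<And>a b. mC (p' a) (q' b) = r' (mB a b)"
    using assms(2) unfolding isotopic_def by blast
  show ?thesis
    unfolding isotopic_def using lin lin' bij bij'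
    by (intro exI[of _ "p' \<circ> p"] exI[of _ "q' \<circ> q"] exI[of _ "r' \<circ> r"])
      (simp add: Vector_Spaces.linear_compose bij_comp eq eq')
qed


section \<open>A two-parameter family of multiplications on coordinate triples\<close>

definition triple_scale :: "'f::field \<Rightarrow> 'f \<times> 'f \<times> 'f \<Rightarrow> 'f \<times> 'f \<times> 'f" where
  "triple_scale c = (\<lambda>(a, b, d). (c * a, c * b, c * d))"

text \<open>The unital commutative algebra with basis \<open>1, x, y\<close> and products \<open>x\<^sup>2 = y\<^sup>2 = 0\<close> and
  \<open>xy = 1 + \<beta>x + \<gamma>y\<close>; the parameters \<open>\<beta> = \<gamma> = 0\<close> give \<open>J\<^sub>2\<close>.\<close>

definition triple_mult :: "'f::field \<Rightarrow> 'f \<Rightarrow> 'f \<times> 'f \<times> 'f \<Rightarrow> 'f \<times> 'f \<times> 'f \<Rightarrow> 'f \<times> 'f \<times> 'f" where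
  "triple_mult \<beta> \<gamma> = (\<lambda>(a0, a1, a2) (b0, b1, b2).
     (a0 * b0 + (a1 * b2 + a2 * b1),
      a0 * b1 + a1 * b0 + \<beta> * (a1 * b2 + a2 * b1),
      a0 * b2 + a2 * b0 + \<gamma> * (a1 * b2 + a2 * b1)))"

lemma vector_space_triple: "vector_space triple_scale"
  by unfold_locales (auto simp: triple_scale_def algebra_simps)

text \<open>Write \<open>Q = a\<^sub>0b\<^sub>0\<close> and \<open>S\<^sub>i\<^sub>j = a\<^sub>ib\<^sub>j + a\<^sub>jb\<^sub>i\<close>. The coordinates of a product are \<open>Q + S\<^sub>1\<^sub>2\<close>,
  \<open>S\<^sub>0\<^sub>1 + \<beta>S\<^sub>1\<^sub>2\<close>, \<open>S\<^sub>0\<^sub>2 + \<gamma>S\<^sub>1\<^sub>2\<close>; these span the same space of bilinear forms as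
  \<open>Q + S\<^sub>1\<^sub>2\<close>, \<open>S\<^sub>0\<^sub>1 - \<beta>Q\<close>, \<open>S\<^sub>0\<^sub>2 - \<gamma>Q\<close>. The forms obtained from \<open>Q + S\<^sub>1\<^sub>2\<close>, \<open>S\<^sub>0\<^sub>1\<close>, \<open>S\<^sub>0\<^sub>2\<close> by
  substituting \<open>\<phi>\<close> in both arguments span this space as well, and \<open>\<xi>\<close> is the change of basis between
  the two spanning triples.\<close>

lemma isotopic_triple_mult_zero:
  fixes \<beta> \<gamma> :: "'f::alg_closed_field"
  assumes two: "(2::'f) \<noteq> 0" and nz: "\<beta> * \<gamma> \<noteq> -2"
  shows "isotopic triple_scale (triple_mult \<beta> \<gamma>) triple_scale (triple_mult 0 0)"
proof -
  \<comment> \<open>Naming the inverse of \<open>2\<close> turns the multiplication identities into ring identities modulo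
    \<open>h * 2 = 1\<close> and the equation for \<open>s\<close>.\<close>
  define h :: 'f where "h = inverse 2"
  have h2: "h * 2 = 1" using two by (simp add: h_def)
  obtain s where s: "s ^ 2 = 1 + h * (\<beta> * \<gamma>)"
    using nth_root_exists[of 2] by auto
  have s0: "s \<noteq> 0"
  proof
    assume "s = 0"
    then have "2 * (1 + h * (\<beta> * \<gamma>)) = 0" using s by simp
    then have "2 + \<beta> * \<gamma> = 0" using h2 by algebra
    then show False using nz by (simp add: add_eq_0_iff)
  qed
  \<comment> \<open>\<open>\<phi>'\<close> and \<open>\<xi>'\<close> are the inverses of \<open>\<phi>\<close> and \<open>\<xi>\<close>.\<close>
  define \<phi> where "\<phi> = (\<lambda>(a0, a1, a2). (s * a0, a1 - h * \<beta> * a0, a2 - h * \<gamma> * a0))"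
  define \<phi>' where "\<phi>' = (\<lambda>(b0, b1, b2). (b0 / s, b1 + h * \<beta> * (b0 / s), b2 + h * \<gamma> * (b0 / s)))"
  define \<xi> where "\<xi> = (\<lambda>(c0, c1, c2).
    ((1 + \<beta> * \<gamma>) * c0 - h * \<gamma> * c1 - h * \<beta> * c2, s * (c1 - \<beta> * c0), s * (c2 - \<gamma> * c0)))"
  define \<xi>' where "\<xi>' = (\<lambda>(d0, d1, d2). let c0 = d0 + h * \<gamma> * (d1 / s) + h * \<beta> * (d2 / s)
    in (c0, d1 / s + \<beta> * c0, d2 / s + \<gamma> * c0))"
  have "Vector_Spaces.linear triple_scale triple_scale \<phi>"
    "Vector_Spaces.linear triple_scale triple_scale \<xi>"
    using vector_space_triple
    by (auto simp: Vector_Spaces.linear_iff \<phi>_def \<xi>_def triple_scale_def algebra_simps)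
  moreover have "bij \<phi>"
    by (rule o_bij[of \<phi>']) (auto simp: fun_eq_iff \<phi>_def \<phi>'_def s0)
  moreover have "bij \<xi>"
  proof (rule o_bij[of \<xi>'])
    have "(1 + \<beta> * \<gamma>) * c0 - h * \<gamma> * c1 - h * \<beta> * c2 + h * (\<gamma> * (c1 - \<beta> * c0))
      + h * (\<beta> * (c2 - \<gamma> * c0)) = c0" for c0 c1 c2
      using h2 by algebra
    then show "\<xi>' \<circ> \<xi> = id"
      by (auto simp: fun_eq_iff \<xi>_def \<xi>'_def s0 Let_def)
    have "(1 + \<beta> * \<gamma>) * c0 - h * \<gamma> * (u + \<beta> * c0) - h * \<beta> * (v + \<gamma> * c0)
      = c0 - h * \<gamma> * u - h * \<beta> * v" for c0 u v
      using h2 by algebra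
    then show "\<xi> \<circ> \<xi>' = id"
      by (auto simp: fun_eq_iff \<xi>_def \<xi>'_def s0 Let_def)
  qed
  moreover have "triple_mult 0 0 (\<phi> a) (\<phi> b) = \<xi> (triple_mult \<beta> \<gamma> a b)" for a b
  proof -
    obtain a0 a1 a2 b0 b1 b2 where ab: "a = (a0, a1, a2)" "b = (b0, b1, b2)"
      by (metis prod.exhaust)
    show ?thesis
      unfolding ab triple_mult_def \<phi>_def \<xi>_def prod.case prod.inject
      using s h2 by (intro conjI; algebra)
  qed
  ultimately show ?thesis
    unfolding isotopic_def by blast
qed


section \<open>Coordinates with respect to a basis of a unit and two nil-elements\<close>

definition lincomb3 ::
  "('f \<Rightarrow> 'a \<Rightarrow> 'a) \<Rightarrow> 'a \<Rightarrow> 'a \<Rightarrow> 'a \<Rightarrow> 'f::field \<times> 'f \<times> 'f \<Rightarrow> 'a::ab_group_add" where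
  "lincomb3 s u v w = (\<lambda>(a, b, c). s a u + s b v + s c w)"

context vector_space
begin

lemma linear_lincomb3: "Vector_Spaces.linear triple_scale scale (lincomb3 scale u v w)"
  using vector_space_triple vector_space_axioms
  by (auto simp: Vector_Spaces.linear_iff triple_scale_def lincomb3_def scale_left_distrib
    scale_right_distrib algebra_simps)

lemma inj_lincomb3_imp_independent:
  assumes "inj (lincomb3 scale u v w)"
  shows "independent {u, v, w}" and "card {u, v, w} = 3"
proof -
  have z: "a = 0 \<and> b = 0 \<and> c = 0" if "scale a u + scale b v + scale c w = 0" for a b c
    using injD[OF assms, of "(a, b, c)" "(0, 0, 0)"] that by (simp add: lincomb3_def)
  have ne: "u \<noteq> v" "u \<noteq> w" "v \<noteq> w"
    using z[of 1 "-1" 0] z[of 1 0 "-1"] z[of 0 1 "-1"] by auto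
  show "card {u, v, w} = 3" using ne by simp
  show "independent {u, v, w}"
  proof (rule independent_if_scalars_zero)
    fix f t assume s: "(\<Sum>t\<in>{u, v, w}. scale (f t) t) = 0" and t: "t \<in> {u, v, w}"
    have "scale (f u) u + scale (f v) v + scale (f w) w = 0"
      using s ne by (simp add: add.assoc)
    from z[OF this] t show "f t = 0" by auto
  qed simp
qed

text \<open>A nonzero value of \<open>dim UNIV\<close> is the cardinality of a finite basis, since \<open>card\<close> is \<open>0\<close> on
  infinite sets; this basis bounds the size of independent sets.\<close>

lemma independent_card_eq_dim_imp_span:
  assumes "independent S" and "finite S" and "card S = dim UNIV" and "dim UNIV \<noteq> 0"
  shows "span S = UNIV"
proof -
  obtain B where B: "independent B" "UNIV \<subseteq> span B" "card B = dim UNIV"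
    using basis_exists[of UNIV] by metis
  have fB: "finite B" using B(3) assms(4) by (metis card.infinite)
  have "v \<in> span S" for v
  proof (rule ccontr)
    assume v: "v \<notin> span S"
    then have i: "independent (insert v S)" and "v \<notin> S"
      using assms(1) by (auto simp: independent_insert span_base)
    have "card (insert v S) \<le> card B"
      using independent_span_bound[OF fB i] B(2) by auto
    then show False using \<open>v \<notin> S\<close> assms(2,3) B(3) by simp
  qed
  then show ?thesis by auto
qed

lemma span_triple: "span {u, v, w} = range (lincomb3 scale u v w)"
proof
  show "range (lincomb3 scale u v w) \<subseteq> span {u, v, w}"
    by (clarsimp simp: lincomb3_def) (simp add: span_add span_scale span_base)
  show "span {u, v, w} \<subseteq> range (lincomb3 scale u v w)"
  proof
    fix p assume "p \<in> span {u, v, w}"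
    then obtain a b c where "p - scale a u - scale b v - scale c w = 0"
      by (auto simp: span_insert)
    then have "p = lincomb3 scale u v w (a, b, c)" by (simp add: lincomb3_def algebra_simps)
    then show "p \<in> range (lincomb3 scale u v w)" by blast
  qed
qed

lemma bij_lincomb3:
  assumes "inj (lincomb3 scale u v w)" and "dim UNIV = 3"
  shows "bij (lincomb3 scale u v w)"
  using independent_card_eq_dim_imp_span[of "{u, v, w}"] inj_lincomb3_imp_independent[OF assms(1)]
    assms by (auto simp: bij_def span_triple)

lemma inj_lincomb3I:
  assumes "\<And>a b c. scale a u + scale b v + scale c w = 0 \<Longrightarrow> a = 0 \<and> b = 0 \<and> c = 0"
  shows "inj (lincomb3 scale u v w)"
proof (rule injI, simp only: split_paired_all)
  fix a b c a' b' c' assume "lincomb3 scale u v w (a, b, c) = lincomb3 scale u v w (a', b', c')"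
  then have "scale (a - a') u + scale (b - b') v + scale (c - c') w = 0"
    by (simp add: lincomb3_def scale_left_diff_distrib algebra_simps)
  from assms[OF this] show "(a, b, c) = (a', b', c')" by simp
qed

end

context nonassoc_algebra
begin

lemma mult_add_left: "mult (a + b) c = mult a c + mult b c"
  and mult_scale_left: "mult (scale k a) c = scale k (mult a c)"
  using linear_mult_left[of c] by (auto simp: Vector_Spaces.linear_iff)

lemma mult_add_right: "mult a (b + c) = mult a b + mult a c"
  and mult_scale_right: "mult a (scale k c) = scale k (mult a c)"
  using linear_mult_right[of a] by (auto simp: Vector_Spaces.linear_iff)

lemmas bilinear_simps = mult_add_left mult_scale_left mult_add_right mult_scale_right

lemma mult_zero_left: "mult 0 c = 0"
  using mult_scale_left[of 0 0 c] by simp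

lemma mult_lincomb3:
  assumes "commutative" and unit: "\<And>a. mult e a = a"
    and "mult x x = 0" "mult y y = 0" "mult x y = e + scale \<beta> x + scale \<gamma> y"
  shows "mult (lincomb3 scale e x y a) (lincomb3 scale e x y b)
    = lincomb3 scale e x y (triple_mult \<beta> \<gamma> a b)"
proof -
  have unit': "mult a e = a" for a using unit assms(1) by (metis commutative_def)
  have yx: "mult y x = e + scale \<beta> x + scale \<gamma> y"
    using assms(1,5) by (metis commutative_def)
  obtain a0 a1 a2 b0 b1 b2 where ab: "a = (a0, a1, a2)" "b = (b0, b1, b2)"
    by (metis prod.exhaust)
  show ?thesis
    unfolding ab
    by (simp add: lincomb3_def triple_mult_def bilinear_simps unit unit' yx assms(3-5)
      scale_left_distrib scale_right_distrib algebra_simps)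
qed

lemma isotopic_triple_mult:
  assumes "commutative" and "\<And>a. mult e a = a"
    and "mult x x = 0" "mult y y = 0" "mult x y = e + scale \<beta> x + scale \<gamma> y"
    and "bij (lincomb3 scale e x y)"
  shows "isotopic triple_scale (triple_mult \<beta> \<gamma>) scale mult"
  unfolding isotopic_def
  using linear_lincomb3[of e x y] assms(6) mult_lincomb3[OF assms(1-5)] by blast


section \<open>Simplicity and nil-rank two\<close>

text \<open>A supremum of cardinalities equal to \<open>2\<close> is attained, because otherwise \<open>1\<close> is an upper
  bound.\<close>

lemma nil_rank_2_imp_pair:
  assumes "nil_rank = 2"
  obtains x y where "x \<in> nil2_elements" "y \<in> nil2_elements" "x \<noteq> y" "independent {x, y}"
proof -
  have "\<exists>S. finite S \<and> S \<subseteq> nil2_elements \<and> independent S \<and> 2 \<le> card S"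
  proof (rule ccontr)
    assume none: "\<not> ?thesis"
    have "nil_rank \<le> 1"
      unfolding nil_rank_def
    proof (rule SUP_least)
      fix S assume "S \<in> {S. finite S \<and> S \<subseteq> nil2_elements \<and> independent S}"
      then have "\<not> 2 \<le> card S" using none by blast
      then show "enat (card S) \<le> 1" by (simp add: one_enat_def)
    qed
    then show False using assms by simp
  qed
  then obtain S where S: "S \<subseteq> nil2_elements" "independent S" "2 \<le> card S" by blast
  obtain T where T: "T \<subseteq> S" "card T = 2" using obtain_subset_with_card_n[OF S(3)] by blast
  then obtain x y where xy: "T = {x, y}" "x \<noteq> y" by (auto simp: card_2_iff)
  show thesis
  proof (rule that)
    show "x \<in> nil2_elements" "y \<in> nil2_elements" using xy T(1) S(1) by auto
    show "independent {x, y}" using independent_mono[OF S(2) T(1)] xy by simp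
  qed (rule xy)
qed

lemma card_independent_nil_le_rank:
  assumes "finite S" "S \<subseteq> nil2_elements" "independent S"
  shows "enat (card S) \<le> nil_rank"
  unfolding nil_rank_def using assms by (intro SUP_upper) auto

text \<open>Multiply a relation \<open>ae + bx + cy = 0\<close> by \<open>x\<close> and by \<open>y\<close>: this gives \<open>ax + c(xy) = 0\<close> and
  \<open>b(xy) + ay = 0\<close>. Eliminating \<open>xy\<close> leaves a relation between \<open>x\<close> and \<open>y\<close> alone.\<close>

lemma inj_unit_nil_pair:
  assumes "commutative" and unit: "\<And>a. mult e a = a"
    and "mult x x = 0" "mult y y = 0" and xy: "x \<noteq> y" "independent {x, y}"
  shows "inj (lincomb3 scale e x y)"
proof (rule inj_lincomb3I)
  have nz: "x \<noteq> 0" "y \<noteq> 0" using xy(2) dependent_zero by auto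
  have ind: "a = 0 \<and> b = 0" if "scale a x + scale b y = 0" for a b
    using independentD[OF xy(2), of "{x, y}" "\<lambda>t. if t = x then a else b" x]
      independentD[OF xy(2), of "{x, y}" "\<lambda>t. if t = x then a else b" y] that xy(1)
    by auto
  have comm: "mult y x = mult x y" using assms(1) by (simp add: commutative_def)
  fix a b c assume z: "scale a e + scale b x + scale c y = 0"
  have "mult (scale a e + scale b x + scale c y) x = 0"
    "mult (scale a e + scale b x + scale c y) y = 0"
    using z by (simp_all add: mult_zero_left)
  then have ax: "scale a x + scale c (mult x y) = 0" and ay: "scale b (mult x y) + scale a y = 0"
    by (simp_all add: bilinear_simps unit assms(3,4) comm algebra_simps)
  have "scale b (scale a x + scale c (mult x y)) - scale c (scale b (mult x y) + scale a y) = 0"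
    using ax ay by simp
  then have "scale (a * b) x + scale (- (a * c)) y = 0"
    by (simp add: scale_right_distrib algebra_simps)
  from ind[OF this] have "a = 0 \<or> (b = 0 \<and> c = 0)" by auto
  then have "a = 0" using ax nz by auto
  then show "a = 0 \<and> b = 0 \<and> c = 0" using z ind[of b c] by simp
qed

text \<open>For \<open>\<alpha> = 0\<close> all products of \<open>x\<close> or \<open>y\<close> with basis elements stay in the plane spanned by
  \<open>x\<close> and \<open>y\<close>, which would thus be an ideal.\<close>

lemma simple_imp_unit_coefficient:
  assumes "simple" "commutative" and unit: "\<And>a. mult e a = a"
    and "mult x x = 0" "mult y y = 0" and m: "mult x y = scale \<alpha> e + scale \<beta> x + scale \<gamma> y"
    and bij: "bij (lincomb3 scale e x y)"
  shows "\<alpha> \<noteq> 0"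
proof
  assume "\<alpha> = 0"
  define I where "I = range (\<lambda>(b, c). lincomb3 scale e x y (0, b, c))"
  have comm: "mult a b = mult b a" for a b using assms(2) by (simp add: commutative_def)
  have I: "scale b x + scale c y \<in> I" for b c
    unfolding I_def by (rule range_eqI[of _ _ "(b, c)"]) (simp add: lincomb3_def)
  have IE: "\<exists>b c. p = scale b x + scale c y" if "p \<in> I" for p
    using that by (auto simp: I_def lincomb3_def)
  have "subspace I"
  proof (rule subspaceI)
    show "0 \<in> I" using I[of 0 0] by simp
    show "p + q \<in> I" if "p \<in> I" "q \<in> I" for p q
    proof -
      obtain b c where p: "p = scale b x + scale c y" using IE \<open>p \<in> I\<close> by blast
      obtain b' c' where q: "q = scale b' x + scale c' y" using IE \<open>q \<in> I\<close> by blast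
      have "p + q = scale (b + b') x + scale (c + c') y"
        unfolding p q by (simp add: scale_left_distrib algebra_simps)
      then show ?thesis using I by simp
    qed
    show "scale k p \<in> I" if pI: "p \<in> I" for k p
    proof -
      obtain b c where "p = scale b x + scale c y" using IE[OF pI] by blast
      then have "scale k p = scale (k * b) x + scale (k * c) y"
        by (simp add: scale_right_distrib)
      then show ?thesis using I by simp
    qed
  qed
  moreover have absorb: "mult a p \<in> I" if pI: "p \<in> I" for a p
  proof -
    obtain b c where p: "p = scale b x + scale c y" using IE[OF pI] by blast
    obtain a0 a1 a2 where a: "a = scale a0 e + scale a1 x + scale a2 y"
      using surjD[OF bij_is_surj[OF bij], of a] by (auto simp: lincomb3_def)
    have "mult a p = scale (a0 * b + (a1 * c + a2 * b) * \<beta>) x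
        + scale (a0 * c + (a1 * c + a2 * b) * \<gamma>) y"
      unfolding a p
      by (simp add: bilinear_simps unit assms(4,5) m comm[of y x] \<open>\<alpha> = 0\<close>
        scale_left_distrib scale_right_distrib algebra_simps)
    then show ?thesis using I by simp
  qed
  moreover have "mult p a \<in> I" if "p \<in> I" for a p
    unfolding comm[of p a] by (rule absorb[OF that])
  ultimately have "ideal I" unfolding ideal_def by blast
  then have "I = {0} \<or> I = UNIV" using assms(1) by (simp add: simple_def)
  then show False
  proof
    assume "I = {0}"
    then have "lincomb3 scale e x y (0, 1, 0) = lincomb3 scale e x y (0, 0, 0)"
      using I[of 1 0] by (simp add: lincomb3_def)
    then show False using bij_is_inj[OF bij] by (auto dest: injD)
  next
    assume "I = UNIV"
    then obtain b c where "e = scale b x + scale c y" using IE[of e] by auto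
    then have "lincomb3 scale e x y (1, 0, 0) = lincomb3 scale e x y (0, b, c)"
      by (simp add: lincomb3_def)
    then show False using bij_is_inj[OF bij] by (auto dest: injD)
  qed
qed

text \<open>An element \<open>ae + bx + cy\<close> with \<open>a \<noteq> 0\<close> has square zero iff \<open>a = -c\<beta> = -b\<gamma>\<close> and
  \<open>a\<^sup>2 = -2bc\<close>, which for \<open>\<beta>\<gamma> = -2\<close> and \<open>c = 1\<close> has the solution \<open>a = -\<beta>\<close>, \<open>b = -\<beta>\<^sup>2/2\<close>. Having
  a nonzero \<open>e\<close>-coordinate, it is independent of \<open>x\<close> and \<open>y\<close>.\<close>

lemma nil_rank_2_imp_parameters:
  assumes "nil_rank = 2" "commutative" and unit: "\<And>a. mult e a = a"
    and "mult x x = 0" "mult y y = 0" and m: "mult x y = e + scale \<beta> x + scale \<gamma> y"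
    and inj: "inj (lincomb3 scale e x y)" and two: "(2::'f) \<noteq> 0"
  shows "\<beta> * \<gamma> \<noteq> -2"
proof
  assume bg: "\<beta> * \<gamma> = -2"
  then have b0: "\<beta> \<noteq> 0" using two by auto
  let ?l = "lincomb3 scale e x y"
  define h :: 'f where "h = inverse 2"
  have h2: "h * 2 = 1" using two by (simp add: h_def)
  define z where "z = ?l (- \<beta>, - (h * \<beta>^2), 1)"
  have "triple_mult \<beta> \<gamma> (- \<beta>, - (h * \<beta>^2), 1) (- \<beta>, - (h * \<beta>^2), 1) = (0, 0, 0)"
    unfolding triple_mult_def prod.case prod.inject
  proof (intro conjI)
    show "- \<beta> * - (h * \<beta>^2) + - (h * \<beta>^2) * - \<beta>
      + \<beta> * (- (h * \<beta>^2) * 1 + 1 * - (h * \<beta>^2)) = 0"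
      by (simp add: algebra_simps)
  qed (use bg h2 in algebra)+
  then have "mult z z = ?l (0, 0, 0)"
    by (simp add: z_def mult_lincomb3[OF assms(2-6)])
  then have zz: "mult z z = 0" by (simp add: lincomb3_def)
  have "inj (lincomb3 scale x y z)"
  proof (rule inj_lincomb3I)
    fix a b c assume "scale a x + scale b y + scale c z = 0"
    then have "?l (- (c * \<beta>), a - c * h * \<beta>^2, b + c) = ?l (0, 0, 0)"
      by (simp add: z_def lincomb3_def scale_right_distrib scale_left_distrib
        scale_left_diff_distrib algebra_simps)
    then have "(- (c * \<beta>), a - c * h * \<beta>^2, b + c) = (0, 0, 0)" by (rule injD[OF inj])
    then show "a = 0 \<and> b = 0 \<and> c = 0" using b0 by auto
  qed
  note ind = inj_lincomb3_imp_independent[OF this]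
  have "0 \<notin> {x, y, z}" using ind(1) dependent_zero[of "{x, y, z}"] by blast
  then have "{x, y, z} \<subseteq> nil2_elements" using assms(4,5) zz by (auto simp: nil2_elements_def)
  from card_independent_nil_le_rank[OF _ this ind(1)] show False
    using ind(2) assms(1) by (simp add: numeral_eq_enat)
qed

lemma isotopic_triple_mult_zero_of_nil_rank_2:
  assumes simple: "simple" and unital: "unital" and comm: "commutative"
    and dim: "dim UNIV = 3" and rank: "nil_rank = 2" and two: "(2::'f) \<noteq> 0"
  obtains \<beta> \<gamma> where "\<beta> * \<gamma> \<noteq> -2" and "isotopic triple_scale (triple_mult \<beta> \<gamma>) scale mult"
proof -
  obtain e where unit: "\<And>a. mult e a = a" using unital by (auto simp: unital_def)
  obtain x y where xy: "x \<in> nil2_elements" "y \<in> nil2_elements" "x \<noteq> y" "independent {x, y}"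
    using nil_rank_2_imp_pair[OF rank] .
  have nil: "mult x x = 0" "mult y y = 0" using xy by (auto simp: nil2_elements_def)
  have bij: "bij (lincomb3 scale e x y)"
    by (rule bij_lincomb3[OF inj_unit_nil_pair[OF comm unit nil xy(3,4)] dim])
  obtain \<alpha> \<beta> \<gamma> where m: "mult x y = scale \<alpha> e + scale \<beta> x + scale \<gamma> y"
    using surjD[OF bij_is_surj[OF bij], of "mult x y"] by (auto simp: lincomb3_def)
  have a0: "\<alpha> \<noteq> 0" using simple_imp_unit_coefficient[OF simple comm unit nil m bij] .
  \<comment> \<open>Rescaling \<open>x\<close> makes the coefficient of \<open>e\<close> equal to \<open>1\<close>; it keeps \<open>\<beta>\<close> and divides \<open>\<gamma>\<close> by \<open>\<alpha>\<close>.\<close>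
  define x' where "x' = scale (inverse \<alpha>) x"
  have nil': "mult x' x' = 0" by (simp add: x'_def bilinear_simps nil)
  have m': "mult x' y = e + scale \<beta> x' + scale (\<gamma> / \<alpha>) y"
    using a0 by (simp add: x'_def bilinear_simps m scale_right_distrib field_simps)
  have inj': "inj (lincomb3 scale e x' y)"
  proof (rule inj_lincomb3I)
    fix a b c assume "scale a e + scale b x' + scale c y = 0"
    then have "lincomb3 scale e x y (a, b * inverse \<alpha>, c) = lincomb3 scale e x y (0, 0, 0)"
      by (simp add: lincomb3_def x'_def)
    from injD[OF bij_is_inj[OF bij] this] show "a = 0 \<and> b = 0 \<and> c = 0" using a0 by auto
  qed
  show thesis
  proof (rule that)
    show "\<beta> * (\<gamma> / \<alpha>) \<noteq> -2"
      by (rule nil_rank_2_imp_parameters[OF rank comm unit nil' nil(2) m' inj' two])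
    show "isotopic triple_scale (triple_mult \<beta> (\<gamma> / \<alpha>)) scale mult"
      by (rule isotopic_triple_mult[OF comm unit nil' nil(2) m' bij_lincomb3[OF inj' dim]])
  qed
qed

end


section \<open>Hyperbolic bases\<close>

lemma (in symmetric_bilinear_form)
  form_add_left: "form (u + w) v = form u v + form w v"
  and form_scale_left: "form (scale c u) v = c * form u v"
  using form_add[of v u w] form_scale[of v c u] by (metis form_sym)+

text \<open>Unless \<open>q\<close> itself is isotropic, \<open>form (p + tq) (p + tq)\<close> is a quadratic polynomial in \<open>t\<close>; a
  square root of a quarter of its discriminant provides a zero.\<close>

lemma (in symmetric_bilinear_form) isotropic_vector_exists:
  assumes "p \<noteq> q" and "independent {p, q}" and closed: "\<And>a::'f. \<exists>r. r^2 = a"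
  shows "\<exists>x. x \<noteq> 0 \<and> form x x = 0"
proof (cases "form q q = 0")
  case True
  then show ?thesis using assms(2) dependent_zero by (metis insertCI)
next
  case False
  obtain r where r: "r^2 = form p q ^ 2 - form p p * form q q" using closed by blast
  define t where "t = (r - form p q) / form q q"
  have t: "t * form q q = r - form p q" using False by (simp add: t_def)
  let ?x = "p + scale t q"
  have expand: "form ?x ?x = form p p + 2 * t * form p q + t^2 * form q q"
    by (simp add: form_add form_scale form_add_left form_scale_left form_sym[of q p]
      power2_eq_square algebra_simps)
  have "form q q * form ?x ?x = 0"
    unfolding expand using r t by algebra
  then have "form ?x ?x = 0" using False by simp
  moreover have "?x \<noteq> 0"
  proof
    assume "?x = 0"
    then have "p = scale (- t) q" by (simp add: eq_neg_iff_add_eq_0)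
    then have "p \<in> span {q}" by (metis span_base span_scale singletonI)
    then show False using assms(1,2) by (simp add: independent_insert)
  qed
  ultimately show ?thesis by blast
qed

lemma (in symmetric_bilinear_form) hyperbolic_pair_exists:
  assumes nondeg: "nondegenerate" and dim: "dim UNIV = 2" and two: "(2::'f) \<noteq> 0"
    and closed: "\<And>a::'f. \<exists>r. r^2 = a"
  obtains x y where "form x x = 0" "form y y = 0" "form x y = 1" "span {x, y} = UNIV"
proof -
  obtain B where B: "independent B" "card B = dim UNIV"
    using basis_exists[of UNIV] by metis
  then obtain p q where "B = {p, q}" "p \<noteq> q" using dim by (auto simp: card_2_iff)
  then obtain x where x: "x \<noteq> 0" "form x x = 0"
    using isotropic_vector_exists B(1) closed by metis
  then obtain v where v: "form x v \<noteq> 0" using nondeg by (auto simp: nondegenerate_def)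
  define w where "w = scale (inverse (form x v)) v"
  have w: "form x w = 1" using v by (simp add: w_def form_scale)
  \<comment> \<open>Adding a multiple \<open>k\<close> of \<open>x\<close> to \<open>w\<close> keeps \<open>form x w = 1\<close> and changes \<open>form w w\<close> by \<open>2k\<close>.\<close>
  define k where "k = - (form w w / 2)"
  define y where "y = w + scale k x"
  have xy: "form x y = 1" by (simp add: y_def form_add form_scale w x)
  have "form y y = form w w + 2 * k"
    by (simp add: y_def form_add form_scale form_add_left form_scale_left form_sym[of w x] w x)
  then have yy: "form y y = 0" using two by (simp add: k_def)
  have "x \<notin> span {y}"
  proof
    assume "x \<in> span {y}"
    then obtain k where "x = scale k y" by (auto simp: span_singleton)
    then have "form x y = k * form y y" using form_scale[of y k y] form_sym by metis
    then show False using xy yy by simp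
  qed
  moreover have "y \<noteq> 0" using xy form_scale[of x 0 0] by auto
  ultimately have "independent {x, y}" "x \<noteq> y" by (auto simp: independent_insert span_base)
  then have "span {x, y} = UNIV"
    using independent_card_eq_dim_imp_span[of "{x, y}"] dim by simp
  with that x xy yy show thesis by blast
qed

lemma (in symmetric_bilinear_form) isotopic_triple_mult_jordan:
  assumes hyp: "form x x = 0" "form y y = 0" "form x y = 1" and span: "span {x, y} = UNIV"
  shows "isotopic triple_scale (triple_mult 0 0) jordan_scale jordan_mult"
proof -
  interpret J: nonassoc_algebra jordan_scale jordan_mult by (rule jordan_algebra)
  let ?l = "lincomb3 jordan_scale (1, 0) (0, x) (0, y)"
  have l: "?l (a, b, c) = (a, scale b x + scale c y)" for a b c
    by (simp add: lincomb3_def jordan_scale_simp)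
  have "inj ?l"
  proof (rule J.inj_lincomb3I)
    fix a b c
    assume "jordan_scale a (1, 0) + jordan_scale b (0, x) + jordan_scale c (0, y) = 0"
    then have "a = 0" and z: "scale b x + scale c y = 0"
      by (simp_all add: jordan_scale_simp zero_prod_def)
    have "form x (scale b x + scale c y) = 0" "form y (scale b x + scale c y) = 0"
      using z form_scale[of _ 0 0] by simp_all
    then show "a = 0 \<and> b = 0 \<and> c = 0"
      using \<open>a = 0\<close> by (simp add: form_add form_scale hyp form_sym[of y x])
  qed
  moreover have "surj ?l"
  proof -
    have "\<exists>t. r = ?l t" for r
    proof (cases r)
      case (Pair a v)
      have "v \<in> span {x, y}" using span by simp
      then obtain b c where "v - scale b x - scale c y = 0" by (auto simp: span_insert)
      then have "r = ?l (a, b, c)" using Pair by (simp add: l algebra_simps)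
      then show ?thesis by blast
    qed
    then show ?thesis by (simp add: surj_def)
  qed
  ultimately have "bij ?l" by (simp add: bij_def)
  moreover have "jordan_mult (0, x) (0, y)
      = (1, 0) + jordan_scale 0 (0, x) + jordan_scale 0 (0, y)"
    using hyp by (simp add: jordan_hyperbolic_basis)
  moreover have "J.commutative" using jordan_mult_commute by (simp add: J.commutative_def)
  ultimately show ?thesis
    using J.isotopic_triple_mult jordan_unit jordan_hyperbolic_basis(1,2)[OF hyp] by blast
qed


section \<open>Isotopy to the Jordan algebra\<close>

theorem theorem1:
  fixes scaleA :: "'f::alg_closed_field \<Rightarrow> 'a::ab_group_add \<Rightarrow> 'a"
    and multA :: "'a \<Rightarrow> 'a \<Rightarrow> 'a"
    and scaleV :: "'f \<Rightarrow> 'v::ab_group_add \<Rightarrow> 'v"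
    and form :: "'v \<Rightarrow> 'v \<Rightarrow> 'f"
  assumes "CHAR('f) \<noteq> 2"
    and "nonassoc_algebra scaleA multA"
    and "nonassoc_algebra.simple scaleA multA"
    and "nonassoc_algebra.unital multA"
    and "nonassoc_algebra.commutative multA"
    and "vector_space.dim scaleA UNIV = 3"
    and "nonassoc_algebra.nil_rank scaleA multA = 2"
    and "symmetric_bilinear_form scaleV form"
    and "symmetric_bilinear_form.nondegenerate form"
    and "vector_space.dim scaleV UNIV = 2"
  shows "isotopic scaleA multA
    (symmetric_bilinear_form.jordan_scale scaleV)
    (symmetric_bilinear_form.jordan_mult scaleV form)"
proof -
  interpret A: nonassoc_algebra scaleA multA by fact
  interpret V: symmetric_bilinear_form scaleV form by fact
  have two: "(2::'f) \<noteq> 0"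
  proof
    assume "(2::'f) = 0"
    then have "CHAR('f) dvd 2" using of_nat_eq_0_iff_char_dvd[where 'a='f, of 2] by simp
    then have "CHAR('f) = 1" using assms(1) two_is_prime_nat by (auto simp: prime_nat_iff)
    then show False by simp
  qed
  obtain \<beta> \<gamma> where ne: "\<beta> * \<gamma> \<noteq> -2"
    and A: "isotopic triple_scale (triple_mult \<beta> \<gamma>) scaleA multA"
    using A.isotopic_triple_mult_zero_of_nil_rank_2[OF assms(3-7) two] .
  have "\<exists>r. r^2 = a" for a :: 'f using nth_root_exists[of 2 a] by auto
  then obtain x y where "form x x = 0" "form y y = 0" "form x y = 1" "V.span {x, y} = UNIV"
    using V.hyperbolic_pair_exists[OF assms(9,10) two] by blast
  note J = V.isotopic_triple_mult_jordan[OF this]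
  show ?thesis
    using isotopic_trans[OF isotopic_sym[OF A]
        isotopic_trans[OF isotopic_triple_mult_zero[OF two ne] J]] .
qed

end
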